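(* Let $\mathcal{L} = A_0 + \mathrm{span}_{\mathbb{R}}(A_1,\ldots,A_d) \subset \mathbb{S}^n$ be an affine space of symmetric matrices of dimension $d$, where $A_0 \in \mathbb{S}^n$ and $A_1,\ldots,A_d \in \mathbb{S}^n$ are linearly independent. Then the dimension of the Gibbs variety $\mathrm{GV}(\mathcal{L})$ is at most $n+d$. If $A_0 = 0$, i.e. $\mathcal{L}$ is a linear space of symmetric matrices, then $\dim \mathrm{GV}(\mathcal{L})$ is at most $n+d-1$.
   Context: $\mathbb{S}^n$ denotes the real vector space of real symmetric $n\times n$ matrices, of dimension $\binom{n+1}{2}$. For $\mathcal{L}\subset \mathbb{S}^n$, the Gibbs manifold is $\mathrm{GM}(\mathcal{L}) = \exp(\mathcal{L})=\{\exp(A): A\in\mathcal{L}\}$, where $\exp$ is the matrix exponential. The Gibbs variety $\mathrm{GV}(\mathcal{L})$ is the Zariski closure of $\mathrm{GM}(\mathcal{L})$ in the space $\mathbb{C}^{\binom{n+1}{2}}$ of complex symmetric $n\times n$ matrices. *)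

theory Defs
  imports "HOL-Analysis.Analysis" "HOL-Library.Extended_Nat"
begin

section \<open>Symmetric matrices and the matrix exponential\<close>

definition sym_matrices :: "('a ^ 'n ^ 'n) set" where
  "sym_matrices = {X. transpose X = X}"

definition matrix_power :: "('a::semiring_1) ^ 'n ^ 'n \<Rightarrow> nat \<Rightarrow> 'a ^ 'n ^ 'n" where
  "matrix_power A k = (((**) A) ^^ k) (mat 1)"

text \<open>The library's \<open>exp\<close> is not applicable to matrices: multiplication \<open>*\<close> on vectors (and
  hence on matrices) is entrywise.\<close>

definition matrix_exp :: "real ^ 'n ^ 'n \<Rightarrow> real ^ 'n ^ 'n" where
  "matrix_exp A = (\<Sum>k. (1 / fact k) *\<^sub>R matrix_power A k)"


section \<open>The Zariski topology on complex symmetric matrices\<close>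

text \<open>The functions on matrices given by polynomials over \<open>\<complex>\<close> in the entries. On symmetric matrices
  the entries \<open>(i, j)\<close> and \<open>(j, i)\<close> agree, so there these are exactly the polynomial functions on
  affine space of dimension \<open>n + 1\<close> choose \<open>2\<close>.\<close>

inductive polynomial_fun :: "(complex ^ 'n ^ 'n \<Rightarrow> complex) \<Rightarrow> bool" where
  const: "polynomial_fun (\<lambda>X. c)"
| entry: "polynomial_fun (\<lambda>X. X $ i $ j)"
| add: "polynomial_fun f \<Longrightarrow> polynomial_fun g \<Longrightarrow> polynomial_fun (\<lambda>X. f X + g X)"
| mult: "polynomial_fun f \<Longrightarrow> polynomial_fun g \<Longrightarrow> polynomial_fun (\<lambda>X. f X * g X)"

definition zero_locus :: "(complex ^ 'n ^ 'n \<Rightarrow> complex) set \<Rightarrow> (complex ^ 'n ^ 'n) set" where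
  "zero_locus F = {X \<in> sym_matrices. \<forall>f\<in>F. f X = 0}"

definition zariski_topology :: "(complex ^ 'n ^ 'n) topology" where
  "zariski_topology =
     topology (\<lambda>U. \<exists>F. F \<subseteq> Collect polynomial_fun \<and> U = sym_matrices - zero_locus F)"

lemma zero_locus_compl: "sym_matrices - zero_locus F = {X \<in> sym_matrices. \<exists>f\<in>F. f X \<noteq> 0}"
  by (auto simp: zero_locus_def)

lemma istopology_zariski:
  "istopology (\<lambda>U :: (complex ^ 'n ^ 'n) set.
     \<exists>F. F \<subseteq> Collect polynomial_fun \<and> U = sym_matrices - zero_locus F)"
  unfolding istopology_def
proof (intro conjI allI impI)
  fix S T :: "(complex ^ 'n ^ 'n) set"
  assume "\<exists>F. F \<subseteq> Collect polynomial_fun \<and> S = sym_matrices - zero_locus F"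
     and "\<exists>F. F \<subseteq> Collect polynomial_fun \<and> T = sym_matrices - zero_locus F"
  then obtain F G where F: "F \<subseteq> Collect polynomial_fun" "S = sym_matrices - zero_locus F"
    and G: "G \<subseteq> Collect polynomial_fun" "T = sym_matrices - zero_locus G" by blast
  let ?H = "{\<lambda>X. f X * g X |f g. f \<in> F \<and> g \<in> G}"
  have "?H \<subseteq> Collect polynomial_fun"
  proof
    fix h assume "h \<in> ?H"
    then obtain f g where h: "h = (\<lambda>X. f X * g X)" and "f \<in> F" "g \<in> G" by blast
    then have "polynomial_fun f" "polynomial_fun g" using F(1) G(1) by auto
    then show "h \<in> Collect polynomial_fun"
      unfolding h mem_Collect_eq by (rule polynomial_fun.mult)
  qed
  moreover have "S \<inter> T = sym_matrices - zero_locus ?H"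
  proof (intro subset_antisym subsetI)
    fix X assume "X \<in> S \<inter> T"
    then obtain f g where X: "X \<in> sym_matrices" and fg: "f \<in> F" "g \<in> G" "f X * g X \<noteq> 0"
      unfolding F(2) G(2) zero_locus_compl by auto
    from fg(1,2) have h: "(\<lambda>X. f X * g X) \<in> ?H" by blast
    show "X \<in> sym_matrices - zero_locus ?H"
      unfolding zero_locus_compl mem_Collect_eq
      by (rule conjI[OF X bexI[OF _ h]]) (rule fg(3))
  next
    fix X assume "X \<in> sym_matrices - zero_locus ?H"
    then have X: "X \<in> sym_matrices" and ex: "\<exists>h\<in>?H. h X \<noteq> 0"
      unfolding zero_locus_compl by simp_all
    from ex obtain f g where "f \<in> F" "g \<in> G" "f X * g X \<noteq> 0" by blast
    with X show "X \<in> S \<inter> T"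
      unfolding F(2) G(2) zero_locus_compl by auto
  qed
  ultimately show "\<exists>F. F \<subseteq> Collect polynomial_fun \<and> S \<inter> T = sym_matrices - zero_locus F"
    by (intro exI[of _ ?H] conjI)
next
  fix K :: "(complex ^ 'n ^ 'n) set set"
  assume "\<forall>S\<in>K. \<exists>F. F \<subseteq> Collect polynomial_fun \<and> S = sym_matrices - zero_locus F"
  then have "\<exists>F. \<forall>S\<in>K. F S \<subseteq> Collect polynomial_fun \<and> S = sym_matrices - zero_locus (F S)"
    by (rule bchoice)
  then obtain F where F: "\<And>S. S \<in> K \<Longrightarrow> F S \<subseteq> Collect polynomial_fun"
      "\<And>S. S \<in> K \<Longrightarrow> S = sym_matrices - zero_locus (F S)"
    by blast
  have "\<Union>K = (\<Union>S\<in>K. S)" by simp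
  also have "\<dots> = (\<Union>S\<in>K. sym_matrices - zero_locus (F S))"
    using F(2) by (rule SUP_cong[OF refl])
  also have "\<dots> = sym_matrices - zero_locus (\<Union>S\<in>K. F S)"
    unfolding zero_locus_compl by auto
  finally have "\<Union>K = sym_matrices - zero_locus (\<Union>S\<in>K. F S)" .
  moreover have "(\<Union>S\<in>K. F S) \<subseteq> Collect polynomial_fun"
    using F(1) by (rule UN_least)
  ultimately show "\<exists>F. F \<subseteq> Collect polynomial_fun \<and> \<Union>K = sym_matrices - zero_locus F"
    by (intro exI conjI)
qed

lemma openin_zariski:
  "openin zariski_topology U \<longleftrightarrow>
     (\<exists>F. F \<subseteq> Collect polynomial_fun \<and> U = sym_matrices - zero_locus F)"
  unfolding zariski_topology_def topology_inverse'[OF istopology_zariski] by (rule refl)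

lemma topspace_zariski [simp]: "topspace zariski_topology = sym_matrices"
proof
  show "topspace zariski_topology \<subseteq> sym_matrices"
    unfolding topspace_def openin_zariski by auto
  have "sym_matrices - zero_locus {\<lambda>X. 1} = sym_matrices"
    by (simp add: zero_locus_def)
  then have "openin zariski_topology sym_matrices"
    unfolding openin_zariski using polynomial_fun.const[of 1]
    by (intro exI[of _ "{\<lambda>X. 1}"]) auto
  then show "sym_matrices \<subseteq> topspace zariski_topology"
    by (rule openin_subset)
qed

lemma closedin_zariski:
  "closedin zariski_topology Z \<longleftrightarrow> (\<exists>F. F \<subseteq> Collect polynomial_fun \<and> Z = zero_locus F)"
proof -
  have sub: "zero_locus F \<subseteq> sym_matrices" for F :: "(complex ^ 'n ^ 'n \<Rightarrow> complex) set"
    by (auto simp: zero_locus_def)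
  have "Z \<subseteq> sym_matrices \<and> sym_matrices - Z = sym_matrices - zero_locus F \<longleftrightarrow> Z = zero_locus F" for F
    using sub[of F] by blast
  then show ?thesis
    unfolding closedin_def openin_zariski topspace_zariski by blast
qed


section \<open>Krull dimension of a topological space\<close>

definition irreducible_space :: "'a topology \<Rightarrow> bool" where
  "irreducible_space X \<longleftrightarrow> topspace X \<noteq> {} \<and>
     (\<forall>C D. closedin X C \<and> closedin X D \<and> topspace X = C \<union> D
        \<longrightarrow> topspace X = C \<or> topspace X = D)"

text \<open>The supremum of the lengths \<open>k\<close> of chains \<open>Z 0 \<subset> \<dots> \<subset> Z k\<close> of irreducible closed subsets.
  The supremum in \<^typ>\<open>enat\<close> assigns dimension \<open>0\<close> to the empty space.\<close>

definition krull_dim :: "'a topology \<Rightarrow> enat" where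
  "krull_dim X = Sup {enat k |k. \<exists>Z :: nat \<Rightarrow> 'a set.
     (\<forall>i\<le>k. closedin X (Z i) \<and> irreducible_space (subtopology X (Z i))) \<and>
     (\<forall>i<k. Z i \<subset> Z (Suc i))}"

definition variety_dim :: "(complex ^ 'n ^ 'n) set \<Rightarrow> enat" where
  "variety_dim V = krull_dim (subtopology zariski_topology V)"


section \<open>Gibbs manifold and Gibbs variety\<close>

definition gibbs_manifold :: "(real ^ 'n ^ 'n) set \<Rightarrow> (real ^ 'n ^ 'n) set" where
  "gibbs_manifold L = matrix_exp ` L"

definition gibbs_variety :: "(real ^ 'n ^ 'n) set \<Rightarrow> (complex ^ 'n ^ 'n) set" where
  "gibbs_variety L =
     zariski_topology closure_of (map_matrix complex_of_real ` gibbs_manifold L)"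

end

theory Submission
  imports Defs "HOL-Library.Function_Algebras" "HOL-Computational_Algebra.Polynomial"
begin

text \<open>The exponential of an \<open>n \<times> n\<close> matrix \<open>X\<close> is a real combination of \<open>X\<^sup>0, \<dots>, X\<^sup>n\<^sup>-\<^sup>1\<close>,
  so the Gibbs manifold lies in the image of the polynomial map
  \<open>(c, y) \<mapsto> \<Sum>k<n. c\<^sub>k (A\<^sub>0 + \<Sum>j. y\<^sub>j A\<^sub>j)\<^sup>k\<close> in \<open>n + d\<close> parameters. If \<open>A\<^sub>0 = 0\<close>, then
  homogeneity allows to set \<open>y\<^sub>1 = 1\<close>, at the price of passing to the Euclidean closure.
  A chain of irreducible closed sets of length \<open>k\<close> gives \<open>k\<close> algebraically independent polynomial
  functions (the \<open>i\<close>-th one vanishes on \<open>Z\<^sub>i\<close> but not on \<open>Z\<^sub>i\<^sub>+\<^sub>1\<close>), whereas counting monomials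
  shows that more than \<open>N\<close> polynomials in \<open>N\<close> parameters are algebraically dependent.\<close>

section \<open>Linear algebra of one operator: iterates and annihilating polynomials\<close>

lemma span_image_lessThan:
  fixes g :: "nat \<Rightarrow> 'a::real_vector"
  assumes "x \<in> span (g ` {..<n})"
  shows "\<exists>c. x = (\<Sum>i<n. c i *\<^sub>R g i)"
  using assms
proof (induction n arbitrary: x)
  case 0
  then show ?case by simp
next
  case (Suc n)
  then have "x \<in> span (insert (g n) (g ` {..<n}))"
    by (simp add: lessThan_Suc)
  then obtain k where "x - k *\<^sub>R g n \<in> span (g ` {..<n})"
    by (auto simp: span_insert)
  from Suc.IH[OF this] obtain c where c: "x - k *\<^sub>R g n = (\<Sum>i<n. c i *\<^sub>R g i)" by blast
  have "x = (\<Sum>i<Suc n. (c(n := k)) i *\<^sub>R g i)"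
    using c by (simp add: algebra_simps)
  then show ?case by blast
qed

text \<open>Adding one iterate at a time preserves independence. The cardinality records that no two
  iterates coincide, which the image set alone would hide.\<close>

lemma independent_iterates:
  fixes f :: "'a::real_vector \<Rightarrow> 'a"
  assumes "\<And>j. j < k \<Longrightarrow> (f ^^ j) v \<notin> span ((\<lambda>i. (f ^^ i) v) ` {..<j})"
  shows "independent ((\<lambda>i. (f ^^ i) v) ` {..<k}) \<and> card ((\<lambda>i. (f ^^ i) v) ` {..<k}) = k"
  using assms
proof (induction k)
  case 0
  then show ?case by (simp add: independent_empty)
next
  case (Suc k)
  let ?S = "(\<lambda>i. (f ^^ i) v) ` {..<k}"
  have IH: "independent ?S \<and> card ?S = k"
    by (rule Suc.IH) (rule Suc.prems, rule less_SucI)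
  have nin: "(f ^^ k) v \<notin> span ?S"
    by (rule Suc.prems) simp
  have eq: "(\<lambda>i. (f ^^ i) v) ` {..<Suc k} = insert ((f ^^ k) v) ?S"
    by (simp only: lessThan_Suc image_insert)
  have "(f ^^ k) v \<notin> ?S"
    using span_base[of "(f ^^ k) v" ?S] nin by (rule contrapos_nn[rotated])
  then have "card (insert ((f ^^ k) v) ?S) = Suc k"
    using IH by (subst card_insert_disjoint) auto
  with independent_insertI[OF nin] IH show ?case
    unfolding eq by blast
qed

text \<open>The operator \<open>p(f)\<close> evaluated at \<open>v\<close>.\<close>

definition poly_op :: "('a::real_vector \<Rightarrow> 'a) \<Rightarrow> real poly \<Rightarrow> 'a \<Rightarrow> 'a" where
  "poly_op f p v = (\<Sum>i\<le>degree p. coeff p i *\<^sub>R (f ^^ i) v)"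

lemma poly_op_bound:
  assumes "degree p \<le> n"
  shows "poly_op f p v = (\<Sum>i\<le>n. coeff p i *\<^sub>R (f ^^ i) v)"
  unfolding poly_op_def using assms
  by (intro sum.mono_neutral_left) (auto simp: coeff_eq_0)

lemma poly_op_0 [simp]: "poly_op f 0 v = 0"
  by (simp add: poly_op_def)

lemma poly_op_add: "poly_op f (p + q) v = poly_op f p v + poly_op f q v"
proof -
  define n where "n = max (degree p) (degree q)"
  have "degree (p + q) \<le> n" "degree p \<le> n" "degree q \<le> n"
    by (auto simp: n_def degree_add_le)
  then show ?thesis
    by (simp add: poly_op_bound algebra_simps sum.distrib)
qed

lemma poly_op_smult: "poly_op f (smult c p) v = c *\<^sub>R poly_op f p v"
proof -
  have "poly_op f (smult c p) v = (\<Sum>i\<le>degree p. coeff (smult c p) i *\<^sub>R (f ^^ i) v)"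
    by (rule poly_op_bound) (rule degree_smult_le)
  also have "\<dots> = c *\<^sub>R poly_op f p v"
    by (simp only: poly_op_def coeff_smult scaleR_sum_right scaleR_scaleR)
  finally show ?thesis .
qed

lemma funpow_linear:
  fixes f :: "'a::real_vector \<Rightarrow> 'a"
  assumes "linear f" shows "linear (f ^^ i)"
proof (induction i)
  case 0
  show ?case by (simp add: linear_iff)
next
  case (Suc i)
  then have "linear (f \<circ> f ^^ i)" using assms by (rule linear_compose)
  then show ?case by (simp only: funpow.simps)
qed

lemma linear_poly_op:
  assumes "linear f" shows "linear (poly_op f p)"
  unfolding poly_op_def[abs_def]
  by (rule linear_compose_sum, rule ballI, rule linear_compose_scale_right,
      rule funpow_linear, rule assms)

lemma poly_op_pCons:
  assumes "linear f"
  shows "poly_op f (pCons a p) v = a *\<^sub>R v + f (poly_op f p v)"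
proof -
  have "poly_op f (pCons a p) v = (\<Sum>i\<le>Suc (degree p). coeff (pCons a p) i *\<^sub>R (f ^^ i) v)"
    by (rule poly_op_bound) (rule degree_pCons_le)
  also have "\<dots> = a *\<^sub>R v + (\<Sum>i\<le>degree p. coeff p i *\<^sub>R f ((f ^^ i) v))"
    by (subst sum.atMost_Suc_shift) simp
  also have "(\<Sum>i\<le>degree p. coeff p i *\<^sub>R f ((f ^^ i) v)) = f (poly_op f p v)"
    by (simp add: poly_op_def linear_sum[OF assms] linear_cmul[OF assms])
  finally show ?thesis .
qed

lemma poly_op_mult:
  assumes "linear f"
  shows "poly_op f (p * q) v = poly_op f p (poly_op f q v)"
proof (induction p)
  case 0
  then show ?case by simp
next
  case (pCons a p)
  then show ?case
    by (simp add: poly_op_add poly_op_smult poly_op_pCons[OF assms])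
qed

lemma poly_op_sum_monom:
  "poly_op f (\<Sum>i<n. monom (c i) i) v = (\<Sum>i<n. c i *\<^sub>R (f ^^ i) v)"
proof (induction n)
  case (Suc n)
  have "poly_op f (monom (c n) n) v = c n *\<^sub>R (f ^^ n) v"
    by (subst poly_op_bound[OF degree_monom_le])
      (simp add: if_distrib[of "\<lambda>c. c *\<^sub>R _"] cong: if_cong)
  with Suc show ?case
    by (simp add: poly_op_add)
qed simp

text \<open>\<open>f\<close> is itself \<open>poly_op\<close> of the variable, and polynomial
  multiplication is commutative.\<close>

lemma poly_op_commute:
  assumes "linear f"
  shows "poly_op f p (f v) = f (poly_op f p v)"
proof -
  have X: "poly_op f [:0, 1:] w = f w" for w
    by (simp only: poly_op_pCons[OF assms] poly_op_0 linear_0[OF assms]) simp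
  have "poly_op f p (poly_op f [:0, 1:] v) = poly_op f [:0, 1:] (poly_op f p v)"
    unfolding poly_op_mult[OF assms, symmetric] by (simp only: mult.commute)
  then show ?thesis unfolding X .
qed

text \<open>Rank-nullity count: extend \<open>I\<close> to a maximal independent subset
  \<open>B\<close> of \<open>S\<close>; only \<open>B - I\<close> contributes to the image.\<close>

lemma dim_image_killed:
  fixes f :: "'a::euclidean_space \<Rightarrow> 'b::euclidean_space"
  assumes "linear f" "independent I" "I \<subseteq> S" "\<And>x. x \<in> I \<Longrightarrow> f x = 0"
  shows "card I + dim (f ` S) \<le> dim S"
proof -
  obtain B where B: "I \<subseteq> B" "B \<subseteq> S" "independent B" "S \<subseteq> span B"
    using maximal_independent_subset_extend[OF assms(3,2)] by blast
  have fin: "finite B" using B(3) by (rule independent_imp_finite)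
  have "f ` S \<subseteq> span (f ` B)"
    using B(4) linear_span_image[OF assms(1), of B] by auto
  also have "\<dots> \<subseteq> span (insert 0 (f ` (B - I)))"
    using assms(4) by (intro span_mono) auto
  finally have "f ` S \<subseteq> span (f ` (B - I))" by simp
  then have "dim (f ` S) \<le> card (f ` (B - I))"
    using fin by (intro dim_le_card) auto
  also have "\<dots> \<le> card (B - I)"
    using fin by (intro card_image_le) auto
  also have "\<dots> = card B - card I"
    using fin B(1) by (intro card_Diff_subset) (auto intro: finite_subset)
  finally show ?thesis
    using card_mono[OF fin B(1)] dim_eq_card_independent[OF B(3)] dim_subset[OF B(2)] by linarith
qed

text \<open>A cyclic subspace of dimension \<open>k\<close> inside \<open>S\<close> is killed by a polynomial \<open>q\<close> of degree \<open>k\<close>,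
  so \<open>q(f) S\<close> is an invariant subspace of dimension at most \<open>dim S - k\<close>. This avoids eigenvalues.\<close>

lemma annihilating_poly:
  fixes f :: "'a::euclidean_space \<Rightarrow> 'a"
  assumes "linear f" "subspace S" "f ` S \<subseteq> S"
  shows "\<exists>p. p \<noteq> 0 \<and> degree p \<le> dim S \<and> (\<forall>v\<in>S. poly_op f p v = 0)"
  using assms(2,3)
proof (induction "dim S" arbitrary: S rule: less_induct)
  case less
  show ?case
  proof (cases "S \<subseteq> {0}")
    case True
    have "poly_op f 1 v = v" for v by (simp add: poly_op_def)
    then show ?thesis using True by (intro exI[of _ 1]) auto
  next
    case False
    then obtain v where v: "v \<in> S" "v \<noteq> 0" by auto
    let ?C = "\<lambda>k. (\<lambda>i. (f ^^ i) v) ` {..<k}"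
    have "\<exists>k. (f ^^ k) v \<in> span (?C k)"
    proof (rule ccontr)
      assume "\<not> ?thesis"
      then have "independent (?C (Suc DIM('a)))" "card (?C (Suc DIM('a))) = Suc DIM('a)"
        using independent_iterates[of "Suc DIM('a)" f v] by simp_all
      then show False using independent_bound[of "?C (Suc DIM('a))"] by simp
    qed
    \<comment> \<open>Minimality of \<open>k\<close> makes the first \<open>k\<close> iterates
      independent, while the next one depends on them.\<close>
    define k where "k = (LEAST k. (f ^^ k) v \<in> span (?C k))"
    have k: "(f ^^ k) v \<in> span (?C k)"
      unfolding k_def using \<open>\<exists>k. _\<close> by (rule LeastI_ex)
    have "(f ^^ j) v \<notin> span (?C j)" if "j < k" for j
      using that unfolding k_def by (rule not_less_Least)
    then have ind: "independent (?C k)" "card (?C k) = k"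
      using independent_iterates[of k f v] by simp_all
    obtain c where c: "(f ^^ k) v = (\<Sum>i<k. c i *\<^sub>R (f ^^ i) v)"
      using span_image_lessThan[OF k] by blast
    \<comment> \<open>The relation for the \<open>k\<close>-th iterate moved to one side:
      \<open>q\<close> is monic of degree \<open>k\<close> with \<open>q(f) v = 0\<close>.\<close>
    define b where "b = (\<lambda>i. - c i)(k := 1)"
    define q where "q = (\<Sum>i<Suc k. monom (b i) i)"
    have coeff_q: "coeff q k = 1"
      by (simp add: q_def coeff_sum b_def)
    then have "q \<noteq> 0" by auto
    have deg_q: "degree q \<le> k"
      unfolding q_def by (intro degree_sum_le) (auto intro: order.trans[OF degree_monom_le])
    have qv: "poly_op f q v = 0"
      unfolding q_def poly_op_sum_monom by (simp add: b_def c sum_negf)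
    have "k > 0"
      using k v(2) by (cases k) auto
    have lin: "linear (poly_op f q)" by (rule linear_poly_op[OF assms(1)])
    \<comment> \<open>\<open>q(f)\<close> commutes with \<open>f\<close>, so it kills every iterate
      of \<open>v\<close> along with \<open>v\<close>.\<close>
    have "?C k \<subseteq> {x \<in> S. poly_op f q x = 0}"
    proof safe
      fix i
      show "(f ^^ i) v \<in> S" using v(1) less.prems(2) by (induction i) auto
      show "poly_op f q ((f ^^ i) v) = 0"
        by (induction i) (simp_all add: qv poly_op_commute[OF assms(1)] linear_0[OF assms(1)])
    qed
    then have le: "k + dim (poly_op f q ` S) \<le> dim S"
      using dim_image_killed[OF lin ind(1), of S] ind(2) by auto
    have sub: "subspace (poly_op f q ` S)"
      by (rule linear_subspace_image[OF lin less.prems(1)])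
    have "f ` poly_op f q ` S \<subseteq> poly_op f q ` S"
    proof safe
      fix x assume "x \<in> S"
      moreover have "f (poly_op f q x) = poly_op f q (f x)"
        by (simp add: poly_op_commute[OF assms(1)])
      ultimately show "f (poly_op f q x) \<in> poly_op f q ` S"
        using less.prems(2) by auto
    qed
    then obtain p where p: "p \<noteq> 0" "degree p \<le> dim (poly_op f q ` S)"
        "\<forall>w\<in>poly_op f q ` S. poly_op f p w = 0"
      using less.hyps[OF _ sub] le \<open>k > 0\<close> by auto
    \<comment> \<open>\<open>q(f)\<close> maps \<open>S\<close> into the smaller subspace that
      \<open>p(f)\<close> kills, and the two degree bounds add up to at most
      \<open>dim S\<close>.\<close>
    show ?thesis
      using p \<open>q \<noteq> 0\<close> le deg_q
      by (intro exI[of _ "p * q"]) (auto simp: poly_op_mult[OF assms(1)] degree_mult_eq)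
  qed
qed

section \<open>Matrix powers and the matrix exponential\<close>

lemma matrix_power_simps [simp]:
  "matrix_power A 0 = mat 1" "matrix_power A (Suc k) = A ** matrix_power A k"
  by (simp_all add: matrix_power_def)

lemma matrix_power_vector:
  "matrix_power (A :: real ^ 'n ^ 'n) k *v v = (((*v) A) ^^ k) v"
  by (induction k) (simp_all flip: matrix_vector_mul_assoc)

lemma linear_matrix_mult_left: "linear ((**) (A :: real ^ 'n ^ 'n))"
  by (rule linearI)
    (simp_all add: matrix_matrix_mult_def vec_eq_iff sum.distrib sum_distrib_left distrib_left
      mult.left_commute)

text \<open>A weak Cayley-Hamilton theorem: an annihilating polynomial of degree \<open>m\<close>
  expresses the \<open>m\<close>-th power by lower ones, so the span of these lower powers is stable
  under left multiplication by \<open>A\<close>.\<close>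

lemma matrix_power_in_span:
  fixes A :: "real ^ 'n ^ 'n"
  shows "matrix_power A k \<in> span (matrix_power A ` {..<CARD('n)})"
proof -
  obtain p where p: "p \<noteq> 0" "degree p \<le> CARD('n)" "\<And>v. poly_op ((*v) A) p v = 0"
    using annihilating_poly[of "(*v) A" UNIV] by (auto simp: matrix_vector_mul_linear)
  let ?m = "degree p"
  let ?W = "span (matrix_power A ` {..<?m})"
  have "linear (\<lambda>M :: real ^ 'n ^ 'n. M *v v)" for v
    by (rule linearI) (simp_all add: matrix_vector_mult_add_rdistrib scaleR_matrix_vector_assoc)
  from linear_sum[OF this]
  have "(\<Sum>i\<le>?m. coeff p i *\<^sub>R matrix_power A i) *v v = poly_op ((*v) A) p v" for v
    by (simp only: poly_op_def matrix_power_vector[symmetric] scaleR_matrix_vector_assoc)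
  then have "(\<Sum>i\<le>?m. coeff p i *\<^sub>R matrix_power A i) = 0"
    using p(3) by (simp add: matrix_eq)
  then have "coeff p ?m *\<^sub>R matrix_power A ?m = - (\<Sum>i<?m. coeff p i *\<^sub>R matrix_power A i)"
    by (simp add: lessThan_Suc_atMost[symmetric] eq_neg_iff_add_eq_0 add.commute)
  also have "\<dots> \<in> ?W"
    by (intro span_neg span_sum span_scale span_base) auto
  finally have "matrix_power A ?m \<in> ?W"
    using p(1) span_scale[of _ _ "inverse (coeff p ?m)"] by fastforce
  have closed: "A ** X \<in> ?W" if "X \<in> ?W" for X
  proof -
    have "A ** X \<in> (**) A ` ?W" using that by blast
    also have "\<dots> = span ((**) A ` matrix_power A ` {..<?m})"
      by (rule linear_span_image[symmetric]) (rule linear_matrix_mult_left)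
    also have "\<dots> \<subseteq> ?W"
    proof (rule span_minimal)
      show "(**) A ` matrix_power A ` {..<?m} \<subseteq> ?W"
      proof safe
        fix i assume "i < ?m"
        then have "Suc i < ?m \<or> Suc i = ?m" by auto
        then have "matrix_power A (Suc i) \<in> ?W"
          using \<open>matrix_power A ?m \<in> ?W\<close> by (metis imageI lessThan_iff span_base)
        then show "A ** matrix_power A i \<in> ?W" by simp
      qed
    qed (rule subspace_span)
    finally show ?thesis .
  qed
  have "matrix_power A k \<in> ?W"
  proof (induction k)
    case 0
    \<comment> \<open>If \<open>?m = 0\<close>, the identity is the power \<open>?m\<close> itself;
      otherwise it is one of the generators.\<close>
    show ?case
      using \<open>matrix_power A ?m \<in> ?W\<close> by (cases "?m = 0") (auto intro!: span_base image_eqI[of _ _ 0])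
  next
    case (Suc k)
    then show ?case by (simp add: closed)
  qed
  also have "?W \<subseteq> span (matrix_power A ` {..<CARD('n)})"
    using p(2) by (intro span_mono) auto
  finally show ?thesis .
qed

text \<open>Comparison with the series of \<open>exp K\<close>, where \<open>K\<close> bounds left
  multiplication by \<open>A\<close>. Hence \<open>matrix_exp\<close> is a genuine limit and no
  default value.\<close>

lemma matrix_exp_sums:
  fixes A :: "real ^ 'n ^ 'n"
  shows "(\<lambda>k. (1 / fact k) *\<^sub>R matrix_power A k) sums matrix_exp A"
proof -
  obtain K where K: "K > 0" "\<And>X :: real ^ 'n ^ 'n. norm (A ** X) \<le> K * norm X"
    using linear_bounded_pos[OF linear_matrix_mult_left[of A]] by blast
  have bound: "norm (matrix_power A k) \<le> K ^ k * norm (mat 1 :: real ^ 'n ^ 'n)" for k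
  proof (induction k)
    case (Suc k)
    have "norm (A ** matrix_power A k) \<le> K * norm (matrix_power A k)" by (simp add: K(2))
    also have "\<dots> \<le> K * (K ^ k * norm (mat 1 :: real ^ 'n ^ 'n))"
      using Suc K(1) by (intro mult_left_mono) auto
    finally show ?case by (simp add: mult_ac)
  qed simp
  have "summable (\<lambda>k. (1 / fact k) *\<^sub>R matrix_power A k)"
  proof (rule summable_comparison_test')
    show "summable (\<lambda>k. inverse (fact k) * K ^ k * norm (mat 1 :: real ^ 'n ^ 'n))"
      using summable_exp[of K] by (rule summable_mult2)
    show "norm ((1 / fact k) *\<^sub>R matrix_power A k)
        \<le> inverse (fact k) * K ^ k * norm (mat 1 :: real ^ 'n ^ 'n)" if "k \<ge> 0" for k
      using mult_left_mono[OF bound[of k], of "inverse (fact k)"]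
      by (simp add: inverse_eq_divide mult.assoc)
  qed
  then show ?thesis
    unfolding matrix_exp_def by (rule summable_sums)
qed

text \<open>All partial sums lie in the span of the first \<open>CARD('n)\<close> powers, and a
  finite-dimensional subspace is closed.\<close>

lemma matrix_exp_eq_poly:
  fixes A :: "real ^ 'n ^ 'n"
  shows "\<exists>c. matrix_exp A = (\<Sum>k<CARD('n). c k *\<^sub>R matrix_power A k)"
proof (rule span_image_lessThan)
  let ?W = "span (matrix_power A ` {..<CARD('n)})"
  have lim: "(\<lambda>m. \<Sum>k<m. (1 / fact k) *\<^sub>R matrix_power A k) \<longlonglongrightarrow> matrix_exp A"
    by (rule matrix_exp_sums[unfolded sums_def])
  have mem: "(\<Sum>k<m. (1 / fact k) *\<^sub>R matrix_power A k) \<in> ?W" for m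
    by (rule span_sum) (rule span_scale[OF matrix_power_in_span])
  have "closed ?W"
    by (rule closed_subspace[OF subspace_span])
  then show "matrix_exp A \<in> ?W"
    by (rule closed_sequentially[OF _ mem lim])
qed

section \<open>Algebraic dependence of polynomials in \<open>N\<close> parameters\<close>

interpretation fun_space: vector_space "\<lambda>(c::complex) (f::'x \<Rightarrow> complex) x. c * f x"
  by unfold_locales (simp_all add: fun_eq_iff algebra_simps)

lemma sum_fun_apply: "(\<Sum>a\<in>I. F a) x = (\<Sum>a\<in>I. F a x)"
  by (induction I rule: infinite_finite_induct) simp_all

text \<open>The dimension bound for independent sets, applied to an indexed family: different
  monomials may coincide as functions, and such a coincidence is itself a relation with coefficients
  \<open>1\<close> and \<open>- 1\<close>.\<close>

lemma linear_relation:
  fixes g :: "nat \<Rightarrow> 'x \<Rightarrow> complex"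
  assumes "finite T" "card T < M" "\<And>m. m < M \<Longrightarrow> g m \<in> fun_space.span T"
  shows "\<exists>c. (\<exists>m<M. c m \<noteq> 0) \<and> (\<forall>x. (\<Sum>m<M. c m * g m x) = 0)"
proof (cases "inj_on g {..<M}")
  case False
  then obtain a b where ab: "a < M" "b < M" "a \<noteq> b" "g a = g b"
    by (auto simp: inj_on_def)
  let ?c = "\<lambda>m. if m = a then 1 else if m = b then - 1 else (0::complex)"
  have "(\<Sum>m<M. ?c m * g m x) = 0" for x
  proof -
    have "(\<Sum>m<M. ?c m * g m x) = (\<Sum>m\<in>{a, b}. ?c m * g m x)"
      by (rule sum.mono_neutral_right) (use ab in auto)
    then show ?thesis using ab by simp
  qed
  then show ?thesis using ab by (intro exI[of _ ?c]) auto
next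
  case True
  have "fun_space.dependent (g ` {..<M})"
  proof (rule ccontr)
    assume "fun_space.independent (g ` {..<M})"
    from fun_space.independent_span_bound[OF assms(1) this] assms(3)
    have "card (g ` {..<M}) \<le> card T" by auto
    then show False using assms(2) by (simp add: card_image[OF True])
  qed
  then obtain u where u: "\<exists>v\<in>g ` {..<M}. u v \<noteq> 0" "(\<Sum>v\<in>g ` {..<M}. (\<lambda>x. u v * v x)) = 0"
    by (auto simp: fun_space.dependent_finite)
  have "(\<Sum>m<M. u (g m) * g m x) = 0" for x
    using fun_cong[OF u(2), of x] by (simp add: sum_fun_apply sum.reindex[OF True])
  then show ?thesis using u(1) by (intro exI[of _ "\<lambda>m. u (g m)"]) auto
qed

definition box_monom :: "nat \<Rightarrow> (nat \<Rightarrow> nat) \<Rightarrow> (nat \<Rightarrow> real) \<Rightarrow> complex" where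
  "box_monom N b z = (\<Prod>i<N. complex_of_real (z i) ^ b i)"

text \<open>Complex polynomials in \<open>N\<close> real variables, of degree at most
  \<open>e\<close> in each variable separately; this makes the monomials easy to count.\<close>

definition box_poly :: "nat \<Rightarrow> nat \<Rightarrow> ((nat \<Rightarrow> real) \<Rightarrow> complex) set" where
  "box_poly N e = fun_space.span (box_monom N ` ({..<N} \<rightarrow>\<^sub>E {..e}))"

lemma finite_box: "finite (box_monom N ` ({..<N} \<rightarrow>\<^sub>E {..e}))"
  by (intro finite_imageI finite_PiE) auto

lemma card_box: "card (box_monom N ` ({..<N} \<rightarrow>\<^sub>E {..e})) \<le> Suc e ^ N"
proof -
  have "card (box_monom N ` ({..<N} \<rightarrow>\<^sub>E {..e})) \<le> card ({..<N} \<rightarrow>\<^sub>E {..e})"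
    by (intro card_image_le finite_PiE) auto
  also have "\<dots> = Suc e ^ N" by (simp add: card_PiE)
  finally show ?thesis .
qed

lemma box_monom_in: "(\<And>i. i < N \<Longrightarrow> b i \<le> e) \<Longrightarrow> box_monom N b \<in> box_poly N e"
  unfolding box_poly_def
  \<comment> \<open>The exponents are restricted because the index set consists of extensional
    functions.\<close>
  by (rule fun_space.span_base, rule image_eqI[of _ _ "restrict b {..<N}"])
    (auto simp: box_monom_def fun_eq_iff intro!: prod.cong)

lemma box_poly_mono: "e \<le> e' \<Longrightarrow> box_poly N e \<subseteq> box_poly N e'"
  unfolding box_poly_def by (intro fun_space.span_mono image_mono PiE_mono) auto

lemma box_poly_add:
  "g \<in> box_poly N e \<Longrightarrow> h \<in> box_poly N e \<Longrightarrow> (\<lambda>z. g z + h z) \<in> box_poly N e"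
  using fun_space.span_add[of g _ h] by (simp add: box_poly_def plus_fun_def)

lemma box_poly_scale: "g \<in> box_poly N e \<Longrightarrow> (\<lambda>z. c * g z) \<in> box_poly N e"
  unfolding box_poly_def by (rule fun_space.span_scale)

lemma box_poly_0: "(\<lambda>z. 0) \<in> box_poly N e"
  using fun_space.span_zero by (simp add: box_poly_def zero_fun_def)

text \<open>Bilinearity reduces the claim to two monomials: span induction over \<open>g\<close>
  against a fixed monomial, then over \<open>h\<close>.\<close>

lemma box_poly_mult:
  assumes "g \<in> box_poly N e" "h \<in> box_poly N e'"
  shows "(\<lambda>z. g z * h z) \<in> box_poly N (e + e')"
proof -
  have sub: "fun_space.subspace {g. (\<lambda>z. g z * h z) \<in> box_poly N (e + e')}" for h
  proof (rule fun_space.subspaceI)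
    fix c g assume "g \<in> {g. (\<lambda>z. g z * h z) \<in> box_poly N (e + e')}"
    then have "(\<lambda>z. c * (g z * h z)) \<in> box_poly N (e + e')"
      by (intro box_poly_scale) simp
    then show "(\<lambda>z. c * g z) \<in> {g. (\<lambda>z. g z * h z) \<in> box_poly N (e + e')}"
      by (simp add: mult.assoc)
  qed (auto simp: box_poly_0 algebra_simps intro: box_poly_add)
  have monom: "(\<lambda>z. box_monom N a z * box_monom N b z) \<in> box_poly N (e + e')"
    if "a \<in> {..<N} \<rightarrow>\<^sub>E {..e}" "b \<in> {..<N} \<rightarrow>\<^sub>E {..e'}" for a b
  proof -
    have "(\<lambda>z. box_monom N a z * box_monom N b z) = box_monom N (\<lambda>i. a i + b i)"
      by (simp add: box_monom_def fun_eq_iff power_add prod.distrib)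
    moreover have "box_monom N (\<lambda>i. a i + b i) \<in> box_poly N (e + e')"
      using that by (intro box_monom_in add_mono) (auto simp: PiE_iff)
    ultimately show ?thesis by simp
  qed
  have left: "(\<lambda>z. g z * box_monom N b z) \<in> box_poly N (e + e')"
    if "b \<in> {..<N} \<rightarrow>\<^sub>E {..e'}" for b
    using fun_space.span_induct[OF assms(1)[unfolded box_poly_def] sub[of "box_monom N b"]]
      monom[OF _ that] by blast
  have "h \<in> {h. (\<lambda>z. h z * g z) \<in> box_poly N (e + e')}"
    using fun_space.span_induct[OF assms(2)[unfolded box_poly_def] sub[of g]] left
    by (force simp: mult.commute)
  then show ?thesis by (simp add: mult.commute)
qed

lemma box_poly_const: "(\<lambda>z. c) \<in> box_poly N e"
  using box_poly_scale[OF box_monom_in[of N "\<lambda>_. 0" e], of c] by (simp add: box_monom_def)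

lemma box_poly_coord: "i < N \<Longrightarrow> (\<lambda>z. complex_of_real (z i)) \<in> box_poly N 1"
proof -
  assume "i < N"
  have "box_monom N (\<lambda>j. if j = i then 1 else 0) z = complex_of_real (z i)" for z
  proof -
    have "box_monom N (\<lambda>j. if j = i then 1 else 0) z
        = (\<Prod>j<N. if j = i then complex_of_real (z j) else 1)"
      unfolding box_monom_def by (intro prod.cong) auto
    then show ?thesis using \<open>i < N\<close> by simp
  qed
  then have "(\<lambda>z. complex_of_real (z i)) = box_monom N (\<lambda>j. if j = i then 1 else 0)"
    by (simp add: fun_eq_iff)
  also have "\<dots> \<in> box_poly N 1" by (rule box_monom_in) simp
  finally show ?thesis .
qed

lemma box_poly_power: "g \<in> box_poly N e \<Longrightarrow> (\<lambda>z. g z ^ m) \<in> box_poly N (m * e)"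
  by (induction m) (auto simp: box_poly_const intro: box_poly_mult)

definition poly_param :: "nat \<Rightarrow> ((nat \<Rightarrow> real) \<Rightarrow> complex) \<Rightarrow> bool" where
  "poly_param N g \<longleftrightarrow> (\<exists>e. g \<in> box_poly N e)"

lemma poly_param_const: "poly_param N (\<lambda>z. c)"
  and poly_param_coord: "i < N \<Longrightarrow> poly_param N (\<lambda>z. complex_of_real (z i))"
  unfolding poly_param_def using box_poly_const box_poly_coord by blast+

lemma poly_param_mult: "poly_param N g \<Longrightarrow> poly_param N h \<Longrightarrow> poly_param N (\<lambda>z. g z * h z)"
  using box_poly_mult by (fastforce simp: poly_param_def)

lemma poly_param_add:
  assumes "poly_param N g" "poly_param N h" shows "poly_param N (\<lambda>z. g z + h z)"
proof -
  from assms obtain e e' where "g \<in> box_poly N e" "h \<in> box_poly N e'"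
    by (auto simp: poly_param_def)
  then have "g \<in> box_poly N (max e e')" "h \<in> box_poly N (max e e')"
    using box_poly_mono[of e "max e e'" N] box_poly_mono[of e' "max e e'" N] by auto
  then show ?thesis unfolding poly_param_def using box_poly_add by blast
qed

lemma poly_param_sum:
  "(\<And>i. i \<in> I \<Longrightarrow> poly_param N (g i)) \<Longrightarrow> poly_param N (\<lambda>z. \<Sum>i\<in>I. g i z)"
  by (induction I rule: infinite_finite_induct) (auto intro: poly_param_const poly_param_add)

text \<open>A monomial in \<open>f 0, \<dots>, f (k - 1)\<close> with exponents below \<open>B\<close> is encoded by the number whose
  base-\<open>B\<close> digits are the exponents; the least significant digit belongs to \<open>f (k - 1)\<close>.\<close>

primrec digit_monom :: "(nat \<Rightarrow> 'x \<Rightarrow> complex) \<Rightarrow> nat \<Rightarrow> nat \<Rightarrow> nat \<Rightarrow> 'x \<Rightarrow> complex" where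
  "digit_monom f B 0 m x = 1"
| "digit_monom f B (Suc k) m x = f k x ^ (m mod B) * digit_monom f B k (m div B) x"

lemma digit_monom_compose:
  "digit_monom (\<lambda>i z. f i (\<phi> z)) B k m z = digit_monom f B k m (\<phi> z)"
  by (induction k arbitrary: m) simp_all

text \<open>Each of the \<open>k\<close> factors is a power with exponent below \<open>B\<close>, so
  it adds at most \<open>B * e\<close> to the degrees.\<close>

lemma digit_monom_box_poly:
  assumes "B > 0" "\<And>i. i < k \<Longrightarrow> f i \<in> box_poly N e"
  shows "digit_monom f B k m \<in> box_poly N (k * B * e)"
  using assms(2)
proof (induction k arbitrary: m)
  case 0
  show ?case by (simp add: box_poly_const)
next
  case (Suc k)
  have "(\<lambda>z. f k z ^ (m mod B)) \<in> box_poly N (m mod B * e)"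
    by (rule box_poly_power) (simp add: Suc.prems)
  also have "\<dots> \<subseteq> box_poly N (B * e)"
    using assms(1) by (intro box_poly_mono mult_right_mono) (auto intro: less_imp_le)
  finally have "(\<lambda>z. f k z ^ (m mod B) * digit_monom f B k (m div B) z) \<in> box_poly N (B * e + k * B * e)"
    by (intro box_poly_mult Suc) (simp_all add: Suc.prems)
  then show ?case by (simp add: algebra_simps)
qed

text \<open>Counting: \<open>B ^ k\<close> monomials live in a space of dimension at most \<open>(k * B * e + 1) ^ N\<close>.\<close>

lemma algebraic_relation:
  assumes "N < k" "\<And>i. i < k \<Longrightarrow> poly_param N (f i)"
  shows "\<exists>B c. (\<exists>m<B ^ k. c m \<noteq> 0) \<and> (\<forall>z. (\<Sum>m<B ^ k. c m * digit_monom f B k m z) = 0)"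
proof -
  have "\<exists>E. \<forall>i<k. f i \<in> box_poly N (E i)"
    using assms(2) unfolding poly_param_def by metis
  then obtain E where E: "\<And>i. i < k \<Longrightarrow> f i \<in> box_poly N (E i)" by blast
  define e where "e = (\<Sum>i<k. E i)"
  have "E i \<le> e" if "i < k" for i
    unfolding e_def using that by (intro member_le_sum) auto
  then have e: "f i \<in> box_poly N e" if "i < k" for i
    using E[OF that] box_poly_mono that by blast
  \<comment> \<open>\<open>B\<close> exceeds \<open>Suc (k * e) ^ N\<close>. The dimension bound is
    thus below \<open>B * B ^ N\<close>, and \<open>N < k\<close> provides the extra factor
    \<open>B\<close>.\<close>
  define B where "B = Suc (Suc (k * e) ^ N)"
  have "Suc (k * B * e) ^ N \<le> (Suc (k * e) * B) ^ N"
    by (intro power_mono) (auto simp: B_def algebra_simps)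
  also have "\<dots> < B * B ^ N"
    unfolding power_mult_distrib by (intro mult_strict_right_mono) (simp_all add: B_def)
  also have "\<dots> = B ^ Suc N" by simp
  also have "\<dots> \<le> B ^ k"
    using assms(1) by (intro power_increasing) (auto simp: B_def)
  finally have "card (box_monom N ` ({..<N} \<rightarrow>\<^sub>E {..k * B * e})) < B ^ k"
    using card_box[of N "k * B * e"] by simp
  from linear_relation[OF finite_box this, of "digit_monom f B k"]
  show ?thesis
    using digit_monom_box_poly[of B k f N e] e by (auto simp: B_def box_poly_def)
qed

section \<open>Polynomial functions, chains of irreducible closed sets, and dimension\<close>

lemma polynomial_fun_power: "polynomial_fun f \<Longrightarrow> polynomial_fun (\<lambda>X. f X ^ m)"
  by (induction m) (auto intro: polynomial_fun.intros)

lemma polynomial_fun_sum: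
  "(\<And>i. i \<in> I \<Longrightarrow> polynomial_fun (g i)) \<Longrightarrow> polynomial_fun (\<lambda>X. \<Sum>i\<in>I. g i X)"
  by (induction I rule: infinite_finite_induct) (auto intro: polynomial_fun.intros)

lemma polynomial_fun_digit_monom:
  "(\<And>i. i < k \<Longrightarrow> polynomial_fun (f i)) \<Longrightarrow> polynomial_fun (digit_monom f B k m)"
proof (induction k arbitrary: m)
  case 0
  then show ?case by (simp add: polynomial_fun.const)
next
  case (Suc k)
  then have "polynomial_fun (\<lambda>X. f k X ^ (m mod B) * digit_monom f B k (m div B) X)"
    by (intro polynomial_fun.mult polynomial_fun_power) simp_all
  then show ?case by simp
qed

lemma continuous_on_polynomial_fun: "polynomial_fun f \<Longrightarrow> continuous_on UNIV f"
  by (induction rule: polynomial_fun.induct) (intro continuous_intros; assumption)+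

lemma poly_param_polynomial_fun:
  assumes "polynomial_fun f" "\<And>i j. poly_param N (\<lambda>z. \<phi> z $ i $ j)"
  shows "poly_param N (\<lambda>z. f (\<phi> z))"
  using assms(1)
  by induction (auto intro: assms(2) poly_param_const poly_param_add poly_param_mult)

text \<open>The vanishing ideal of \<open>Z\<close> is prime.\<close>

definition prime_on :: "(complex ^ 'n ^ 'n) set \<Rightarrow> bool" where
  "prime_on Z \<longleftrightarrow> Z \<noteq> {} \<and> (\<forall>g h. polynomial_fun g \<and> polynomial_fun h \<and> (\<forall>X\<in>Z. g X * h X = 0)
     \<longrightarrow> (\<forall>X\<in>Z. g X = 0) \<or> (\<forall>X\<in>Z. h X = 0))"

text \<open>Extract the lowest power \<open>a\<close> of \<open>f k\<close> from a relation on \<open>Z (Suc k)\<close>: since \<open>f k\<close> does not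
  vanish there, primality allows to cancel \<open>f k ^ a\<close>; restricting to \<open>Z k\<close>, where \<open>f k\<close> vanishes,
  leaves a relation between the remaining functions.\<close>

lemma chain_independent:
  fixes Z :: "nat \<Rightarrow> (complex ^ 'n ^ 'n) set"
  assumes "\<And>i. i \<le> k \<Longrightarrow> prime_on (Z i)"
    and "\<And>i. i < k \<Longrightarrow> Z i \<subseteq> Z (Suc i)"
    and "\<And>i. i < k \<Longrightarrow> polynomial_fun (f i)"
    and "\<And>i X. i < k \<Longrightarrow> X \<in> Z i \<Longrightarrow> f i X = 0"
    and "\<And>i. i < k \<Longrightarrow> \<exists>X\<in>Z (Suc i). f i X \<noteq> 0"
    and "\<And>X. X \<in> Z k \<Longrightarrow> (\<Sum>m<B ^ k. c m * digit_monom f B k m X) = 0"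
    and "m < B ^ k"
  shows "c m = 0"
  using assms
proof (induction k arbitrary: c m)
  case 0
  then obtain X where "X \<in> Z 0" by (auto simp: prime_on_def)
  then have "(\<Sum>m<B ^ 0. c m * digit_monom f B 0 m X) = 0" by (rule 0(6))
  with 0(7) show ?case by simp
next
  case (Suc k)
  \<comment> \<open>With \<open>m = q * B + a\<close>, the last digit \<open>a\<close> is the
    exponent of \<open>f k\<close>; \<open>G a\<close> is the coefficient of \<open>f k ^ a\<close>,
    a combination of monomials in the earlier functions.\<close>
  define G where "G a X = (\<Sum>q<B ^ k. c (q * B + a) * digit_monom f B k q X)" for a X
  have pG: "polynomial_fun (G a)" for a
    unfolding G_def[abs_def]
    by (intro polynomial_fun_sum polynomial_fun.mult polynomial_fun.const polynomial_fun_digit_monom)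
      (simp add: Suc.prems(3))
  have pf: "polynomial_fun (f k)" by (simp add: Suc.prems(3))
  have expand: "(\<Sum>m<B ^ Suc k. c m * digit_monom f B (Suc k) m X) = (\<Sum>a<B. f k X ^ a * G a X)" for X
  proof -
    have "(\<Sum>m<B ^ Suc k. c m * digit_monom f B (Suc k) m X)
        = (\<Sum>q<B ^ k. \<Sum>m\<in>{q * B..<q * B + B}. c m * digit_monom f B (Suc k) m X)"
      by (subst sum.nat_group) (simp add: mult.commute)
    also have "\<dots> = (\<Sum>q<B ^ k. \<Sum>a<B. c (q * B + a) * digit_monom f B (Suc k) (q * B + a) X)"
    proof (rule sum.cong[OF refl])
      fix q
      show "(\<Sum>m\<in>{q * B..<q * B + B}. c m * digit_monom f B (Suc k) m X)
          = (\<Sum>a<B. c (q * B + a) * digit_monom f B (Suc k) (q * B + a) X)"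
        using sum.shift_bounds_nat_ivl[of "\<lambda>m. c m * digit_monom f B (Suc k) m X" 0 "q * B" B]
        by (simp only: add_0_right atLeast0LessThan add.commute[of _ "q * B"])
    qed
    also have "\<dots> = (\<Sum>q<B ^ k. \<Sum>a<B. f k X ^ a * (c (q * B + a) * digit_monom f B k q X))"
      by (intro sum.cong refl) (simp add: mult_ac)
    also have "\<dots> = (\<Sum>a<B. f k X ^ a * G a X)"
      unfolding G_def sum_distrib_left by (rule sum.swap)
    finally show ?thesis .
  qed
  have zero: "\<forall>q<B ^ k. c (q * B + a) = 0" if "a < B" for a
    using that
  proof (induction a rule: less_induct)
    case (less a)
    \<comment> \<open>The terms with exponent above \<open>a\<close>, divided by
      \<open>f k ^ Suc a\<close>.\<close>
    define R where "R X = (\<Sum>b\<in>{Suc a..<B}. f k X ^ (b - Suc a) * G b X)" for X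
    have pR: "polynomial_fun R"
      unfolding R_def[abs_def] by (intro polynomial_fun_sum polynomial_fun.mult polynomial_fun_power pf pG)
    have low: "G b X = 0" if "b < a" for b X
      using less.IH[OF that] less.prems that by (simp add: G_def)
    have "f k X ^ a * (G a X + f k X * R X) = 0" if "X \<in> Z (Suc k)" for X
    proof -
      have "0 = (\<Sum>b<B. f k X ^ b * G b X)"
        using Suc.prems(6)[OF that] by (simp only: expand)
      also have "\<dots> = (\<Sum>b\<in>{a..<B}. f k X ^ b * G b X)"
        by (rule sum.mono_neutral_right) (auto simp: low)
      also have "\<dots> = f k X ^ a * G a X + (\<Sum>b\<in>{Suc a..<B}. f k X ^ b * G b X)"
        using less.prems by (rule sum.atLeast_Suc_lessThan)
      also have "(\<Sum>b\<in>{Suc a..<B}. f k X ^ b * G b X) = f k X ^ a * (f k X * R X)"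
        unfolding R_def sum_distrib_left
      proof (intro sum.cong refl)
        fix b assume "b \<in> {Suc a..<B}"
        then have "b = a + (1 + (b - Suc a))" by simp
        then have "f k X ^ b = f k X ^ a * (f k X * f k X ^ (b - Suc a))"
          by (metis power_add power_one_right)
        then show "f k X ^ b * G b X = f k X ^ a * (f k X * (f k X ^ (b - Suc a) * G b X))"
          by simp
      qed
      finally show ?thesis by (simp add: distrib_left)
    qed
    moreover have "polynomial_fun (\<lambda>X. f k X ^ a)" "polynomial_fun (\<lambda>X. G a X + f k X * R X)"
      by (intro polynomial_fun_power polynomial_fun.add polynomial_fun.mult pf pG pR)+
    moreover have "prime_on (Z (Suc k))" using Suc.prems(1) by simp
    ultimately have "(\<forall>X\<in>Z (Suc k). f k X ^ a = 0) \<or> (\<forall>X\<in>Z (Suc k). G a X + f k X * R X = 0)"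
      unfolding prime_on_def by blast
    moreover have "\<not> (\<forall>X\<in>Z (Suc k). f k X ^ a = 0)"
      using Suc.prems(5)[of k] by auto
    ultimately have "\<forall>X\<in>Z (Suc k). G a X + f k X * R X = 0" by blast
    then have Ga: "G a X = 0" if "X \<in> Z k" for X
      using that Suc.prems(2)[of k] Suc.prems(4)[of k X] by force
    show ?case
    proof (intro allI impI)
      fix q assume q: "q < B ^ k"
      show "c (q * B + a) = 0"
      proof (rule Suc.IH[of "\<lambda>q. c (q * B + a)"])
        show "(\<Sum>q<B ^ k. c (q * B + a) * digit_monom f B k q X) = 0" if "X \<in> Z k" for X
          using Ga[OF that] by (simp only: G_def)
        show "prime_on (Z i)" if "i \<le> k" for i
          using that by (intro Suc.prems(1)) simp
      qed (assumption | rule q Suc.prems(2-5) less_SucI)+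
    qed
  qed
  \<comment> \<open>For \<open>B = 0\<close> there is no \<open>m < B ^ Suc k\<close>; for
    \<open>B > 0\<close> division with remainder recovers the digits of \<open>m\<close>.\<close>
  have "B > 0" using Suc.prems(7) by (cases "B = 0") auto
  then have "m mod B < B" "m div B < B ^ k"
    using Suc.prems(7) by (auto simp: less_mult_imp_div_less mult.commute)
  from zero[OF this(1)] this(2) have "c (m div B * B + m mod B) = 0" by blast
  then show ?case by simp
qed

text \<open>If \<open>g * h\<close> vanishes on \<open>Z\<close>, then \<open>Z\<close> is the union
  of two closed subsets, cut out by \<open>g\<close> and by \<open>h\<close>, and irreducibility
  selects one of them.\<close>

lemma irreducible_prime_on:
  assumes "closedin (subtopology zariski_topology V) Z"
    and "irreducible_space (subtopology (subtopology zariski_topology V) Z)"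
  shows "prime_on Z"
  unfolding prime_on_def
proof (intro conjI allI impI)
  let ?T = "subtopology (subtopology zariski_topology V) Z"
  have sub: "Z \<subseteq> sym_matrices" "Z \<subseteq> V"
    using closedin_subset[OF assms(1)] by auto
  then have top: "topspace ?T = Z" by auto
  show "Z \<noteq> {}" using assms(2) top unfolding irreducible_space_def by simp
  fix g h :: "complex ^ 'a ^ 'a \<Rightarrow> complex"
  assume gh: "polynomial_fun g \<and> polynomial_fun h \<and> (\<forall>X\<in>Z. g X * h X = 0)"
  have cl: "closedin ?T (Z \<inter> zero_locus {p})" if "polynomial_fun p" for p
  proof -
    have "closedin zariski_topology (zero_locus {p})"
      using that by (auto simp: closedin_zariski)
    then show ?thesis
      using sub by (auto simp: subtopology_subtopology closedin_subtopology)
  qed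
  have "Z = (Z \<inter> zero_locus {g}) \<union> (Z \<inter> zero_locus {h})"
    using gh sub by (auto simp: zero_locus_def)
  then have "Z = Z \<inter> zero_locus {g} \<or> Z = Z \<inter> zero_locus {h}"
    using assms(2) cl gh unfolding irreducible_space_def top by blast
  then show "(\<forall>X\<in>Z. g X = 0) \<or> (\<forall>X\<in>Z. h X = 0)"
    by (auto simp: zero_locus_def)
qed

text \<open>One of the equations defining \<open>Z\<close> fails at a point of \<open>Y\<close>
  outside \<open>Z\<close>. This supplies the function attached to each step of a chain.\<close>

lemma zariski_separating:
  assumes "closedin (subtopology zariski_topology V) Z" "Y \<subseteq> V" "Y \<subseteq> sym_matrices" "\<not> Y \<subseteq> Z"
  shows "\<exists>f. polynomial_fun f \<and> (\<forall>X\<in>Z. f X = 0) \<and> (\<exists>X\<in>Y. f X \<noteq> 0)"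
proof -
  obtain F where F: "F \<subseteq> Collect polynomial_fun" "Z = zero_locus F \<inter> V"
    using assms(1) by (auto simp: closedin_subtopology closedin_zariski)
  obtain X where X: "X \<in> Y" "X \<in> sym_matrices" "X \<notin> zero_locus F"
    using assms(2-4) F(2) by blast
  then obtain f where "f \<in> F" "f X \<noteq> 0"
    by (auto simp: zero_locus_def)
  then show ?thesis using F X(1) by (auto simp: zero_locus_def)
qed

text \<open>More than \<open>N\<close> functions attached to a chain satisfy a relation after
  pullback along \<open>\<phi>\<close>. It holds on the range of \<open>\<phi>\<close>, by
  continuity on its Euclidean closure, hence on the Zariski closure of \<open>S\<close>, against
  \<open>chain_independent\<close>.\<close>

lemma variety_dim_closure_le:
  fixes \<phi> :: "(nat \<Rightarrow> real) \<Rightarrow> complex ^ 'n ^ 'n"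
  assumes "\<And>i j. poly_param N (\<lambda>z. \<phi> z $ i $ j)" and "S \<subseteq> closure (range \<phi>)"
  shows "variety_dim (zariski_topology closure_of S) \<le> enat N"
proof -
  let ?V = "zariski_topology closure_of S"
  have le: "k \<le> N" if cl: "\<And>i. i \<le> k \<Longrightarrow> closedin (subtopology zariski_topology ?V) (Z i)"
    and irr: "\<And>i. i \<le> k \<Longrightarrow> irreducible_space (subtopology (subtopology zariski_topology ?V) (Z i))"
    and chain: "\<And>i. i < k \<Longrightarrow> Z i \<subset> Z (Suc i)" for k Z
  proof (rule ccontr)
    assume "\<not> k \<le> N"
    have sub: "Z i \<subseteq> ?V" "Z i \<subseteq> sym_matrices" if "i \<le> k" for i
      using closedin_subset[OF cl[OF that]] by auto
    have "\<exists>f. polynomial_fun f \<and> (\<forall>X\<in>Z i. f X = 0) \<and> (\<exists>X\<in>Z (Suc i). f X \<noteq> 0)" if "i < k" for i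
    proof -
      have "Z (Suc i) \<subseteq> ?V" "Z (Suc i) \<subseteq> sym_matrices" "\<not> Z (Suc i) \<subseteq> Z i"
        using sub[of "Suc i"] chain[OF that] that by auto
      with zariski_separating[OF cl, of i "Z (Suc i)"] that show ?thesis by fastforce
    qed
    then have "\<exists>f. \<forall>i<k. polynomial_fun (f i) \<and> (\<forall>X\<in>Z i. f i X = 0) \<and> (\<exists>X\<in>Z (Suc i). f i X \<noteq> 0)"
      by metis
    then obtain f where f: "\<And>i. i < k \<Longrightarrow> polynomial_fun (f i)"
        "\<And>i X. i < k \<Longrightarrow> X \<in> Z i \<Longrightarrow> f i X = 0" "\<And>i. i < k \<Longrightarrow> \<exists>X\<in>Z (Suc i). f i X \<noteq> 0"
      by blast
    have "poly_param N (\<lambda>z. f i (\<phi> z))" if "i < k" for i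
      using f(1)[OF that] assms(1) by (rule poly_param_polynomial_fun)
    with algebraic_relation[of N k "\<lambda>i z. f i (\<phi> z)"] \<open>\<not> k \<le> N\<close>
    obtain B c m where c: "m < B ^ k" "c m \<noteq> 0"
      and rel: "\<And>z. (\<Sum>m<B ^ k. c m * digit_monom f B k m (\<phi> z)) = 0"
      unfolding digit_monom_compose by auto
    define h where "h X = (\<Sum>m<B ^ k. c m * digit_monom f B k m X)" for X
    have ph: "polynomial_fun h"
      unfolding h_def[abs_def]
      by (intro polynomial_fun_sum polynomial_fun.mult polynomial_fun.const polynomial_fun_digit_monom f)
    have "closed {X. h X = 0}"
      using continuous_on_polynomial_fun[OF ph] by (intro closed_Collect_eq) auto
    then have "closure (range \<phi>) \<subseteq> {X. h X = 0}"
      using rel by (intro closure_minimal) (auto simp: h_def)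
    \<comment> \<open>\<open>\<phi>\<close> may take non-symmetric values, but the Zariski closure
      only sees the symmetric points of \<open>S\<close>.\<close>
    then have "sym_matrices \<inter> S \<subseteq> zero_locus {h}"
      using assms(2) by (auto simp: zero_locus_def)
    moreover have "closedin zariski_topology (zero_locus {h})"
      using ph by (auto simp: closedin_zariski)
    ultimately have "?V \<subseteq> zero_locus {h}"
      by (subst closure_of_restrict) (simp add: closure_of_minimal)
    then have hZ: "h X = 0" if "X \<in> Z k" for X
      using that sub[of k] by (auto simp: zero_locus_def)
    have "c m = 0"
    proof (rule chain_independent[where Z = Z and f = f and k = k and B = B])
      show "prime_on (Z i)" if "i \<le> k" for i
        using cl[OF that] irr[OF that] by (rule irreducible_prime_on)
      show "Z i \<subseteq> Z (Suc i)" if "i < k" for i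
        using chain[OF that] by blast
      show "(\<Sum>m<B ^ k. c m * digit_monom f B k m X) = 0" if "X \<in> Z k" for X
        using hZ[OF that] by (simp only: h_def)
    qed (fact f c)+
    with c(2) show False by simp
  qed
  show ?thesis
    unfolding variety_dim_def krull_dim_def
  proof (rule Sup_least, elim CollectE exE conjE)
    fix x k and Z :: "nat \<Rightarrow> (complex ^ 'n ^ 'n) set"
    assume "x = enat k"
      "\<forall>i\<le>k. closedin (subtopology zariski_topology ?V) (Z i) \<and>
        irreducible_space (subtopology (subtopology zariski_topology ?V) (Z i))"
      "\<forall>i<k. Z i \<subset> Z (Suc i)"
    then show "x \<le> enat N" using le[of k Z] by simp
  qed
qed

section \<open>Parametrisation of Gibbs manifolds and the dimension bounds\<close>

lemma continuous_on_matrix_power: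
  fixes X :: "'a::topological_space \<Rightarrow> real ^ 'n ^ 'n"
  assumes "continuous_on T X"
  shows "continuous_on T (\<lambda>t. matrix_power (X t) k)"
proof (induction k)
  case (Suc k)
  have "continuous_on T (\<lambda>t. X t ** matrix_power (X t) k)"
    unfolding matrix_matrix_mult_def
    by (intro continuous_on_vec_lambda continuous_on_sum continuous_on_mult continuous_on_component
        assms Suc)
  then show ?case by simp
qed simp

lemma continuous_on_map_matrix_of_real:
  assumes "continuous_on T X"
  shows "continuous_on T (\<lambda>t. map_matrix complex_of_real (X t :: real ^ 'n ^ 'n))"
  unfolding map_matrix_def
  by (intro continuous_on_vec_lambda continuous_on_of_real continuous_on_component assms)

lemma matrix_power_scaleR:
  "matrix_power (s *\<^sub>R X :: real ^ 'n ^ 'n) k = s ^ k *\<^sub>R matrix_power X k"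
proof (induction k)
  case (Suc k)
  have "(s *\<^sub>R X) ** (s ^ k *\<^sub>R matrix_power X k) = (s * s ^ k) *\<^sub>R (X ** matrix_power X k)"
    by (simp add: linear_cmul[OF linear_matrix_mult_left] flip: scalar_matrix_assoc)
  with Suc show ?case by simp
qed simp

text \<open>The coefficients of the powers are free coordinates instead of the functions of the
  matrix that yield its exponential; this makes the entries polynomial.\<close>

definition gibbs_param ::
    "real ^ 'n ^ 'n \<Rightarrow> (nat \<Rightarrow> real ^ 'n ^ 'n) \<Rightarrow> nat \<Rightarrow> (nat \<Rightarrow> real) \<Rightarrow> complex ^ 'n ^ 'n"
  where "gibbs_param C0 C e z = map_matrix complex_of_real
     (\<Sum>k<CARD('n). z k *\<^sub>R matrix_power (C0 + (\<Sum>j<e. z (CARD('n) + j) *\<^sub>R C j)) k)"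

lemma poly_param_gibbs_param:
  fixes C0 :: "real ^ 'n ^ 'n"
  shows "poly_param (CARD('n) + e) (\<lambda>z. gibbs_param C0 C e z $ a $ b)"
proof -
  define Y where "Y z = C0 + (\<Sum>j<e. z (CARD('n) + j) *\<^sub>R C j)" for z
  have Y: "poly_param (CARD('n) + e) (\<lambda>z. complex_of_real (Y z $ i $ j))" for i j
    unfolding Y_def
    by (auto intro!: poly_param_add poly_param_sum poly_param_mult poly_param_const poly_param_coord)
  have P: "poly_param (CARD('n) + e) (\<lambda>z. complex_of_real (matrix_power (Y z) k $ i $ j))" for k i j
  proof (induction k arbitrary: i j)
    case 0
    show ?case by (simp add: poly_param_const)
  next
    case (Suc k)
    then show ?case
      by (auto simp: matrix_matrix_mult_def intro!: poly_param_sum poly_param_mult Y)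
  qed
  show ?thesis
    unfolding gibbs_param_def Y_def[symmetric] map_matrix_def
    by (auto intro!: poly_param_sum poly_param_mult poly_param_coord P)
qed

lemma gibbs_param_range:
  fixes C0 :: "real ^ 'n ^ 'n"
  shows "map_matrix complex_of_real (\<Sum>k<CARD('n). c k *\<^sub>R matrix_power (C0 + (\<Sum>j<e. y j *\<^sub>R C j)) k)
    \<in> range (gibbs_param C0 C e)"
  \<comment> \<open>The witness lists the coefficients \<open>c\<close> first, then the
    \<open>y j\<close> shifted by \<open>CARD('n)\<close>.\<close>
  by (rule image_eqI[of _ _ "\<lambda>i. if i < CARD('n) then c i else y (i - CARD('n))"])
    (simp_all add: gibbs_param_def)

theorem theorem2p4:
  fixes A0 :: "real ^ 'n ^ 'n" and A :: "nat \<Rightarrow> real ^ 'n ^ 'n" and d :: nat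
    and L :: "(real ^ 'n ^ 'n) set"
  assumes "A0 \<in> sym_matrices"
    and "A ` {1..d} \<subseteq> sym_matrices"
    and "inj_on A {1..d}" and "independent (A ` {1..d})"
    and "L = {A0 + M |M. M \<in> span (A ` {1..d})}"
  shows "variety_dim (gibbs_variety L) \<le> enat (CARD('n) + d) \<and>
    (A0 = 0 \<longrightarrow> variety_dim (gibbs_variety L) \<le> enat (CARD('n) + d - 1))"
proof -
  \<comment> \<open>The generators are renumbered from \<open>0\<close> to match the coordinates of
    the parametrisation.\<close>
  have L: "\<exists>y. X = A0 + (\<Sum>j<d. y j *\<^sub>R A (Suc j))" if "X \<in> L" for X
  proof -
    have "A ` {1..d} = (\<lambda>j. A (Suc j)) ` {..<d}"
      by (simp only: image_Suc_lessThan[symmetric] image_image)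
    then show ?thesis
      using that span_image_lessThan[of _ "\<lambda>j. A (Suc j)" d] unfolding assms(5) by fastforce
  qed
  have "variety_dim (gibbs_variety L) \<le> enat (CARD('n) + d)"
    unfolding gibbs_variety_def gibbs_manifold_def image_image
  proof (rule variety_dim_closure_le[OF poly_param_gibbs_param])
    show "(\<lambda>X. map_matrix complex_of_real (matrix_exp X)) ` L
        \<subseteq> closure (range (gibbs_param A0 (\<lambda>j. A (Suc j)) d))"
    proof safe
      fix X assume "X \<in> L"
      with L obtain y where y: "X = A0 + (\<Sum>j<d. y j *\<^sub>R A (Suc j))" by blast
      obtain c where c: "matrix_exp X = (\<Sum>k<CARD('n). c k *\<^sub>R matrix_power X k)"
        using matrix_exp_eq_poly by blast
      show "map_matrix complex_of_real (matrix_exp X)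
          \<in> closure (range (gibbs_param A0 (\<lambda>j. A (Suc j)) d))"
        unfolding c unfolding y by (rule subsetD[OF closure_subset gibbs_param_range])
    qed
  qed
  moreover have "variety_dim (gibbs_variety L) \<le> enat (CARD('n) + d - 1)" if "A0 = 0"
  proof (cases d)
    case 0
    \<comment> \<open>There is no direction to normalise, but \<open>L\<close> is
      \<open>{0}\<close>, and a constant map is polynomial in any number of parameters, in
      particular \<open>CARD('n) - 1\<close>.\<close>
    let ?E = "map_matrix complex_of_real (matrix_exp (0 :: real ^ 'n ^ 'n))"
    have "(\<lambda>X. map_matrix complex_of_real (matrix_exp X)) ` L \<subseteq> closure (range (\<lambda>z. ?E))"
      using L closure_subset[of "range (\<lambda>z :: nat \<Rightarrow> real. ?E)"] by (auto simp: 0 that)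
    then show ?thesis
      unfolding gibbs_variety_def gibbs_manifold_def image_image
      by (rule variety_dim_closure_le[OF poly_param_const])
  next
    case (Suc e)
    text \<open>Scaling \<open>A 1\<close> to coefficient \<open>1\<close> saves a parameter; the scalar is absorbed by the
      coefficients of the powers. Matrices with \<open>y 0 = 0\<close> are only limits of such points.\<close>
    let ?\<phi> = "gibbs_param (A 1) (\<lambda>j. A (Suc (Suc j))) e"
    have "(\<lambda>X. map_matrix complex_of_real (matrix_exp X)) ` L \<subseteq> closure (range ?\<phi>)"
    proof safe
      fix X assume "X \<in> L"
      with L that obtain y where "X = (\<Sum>j<Suc e. y j *\<^sub>R A (Suc j))" by (auto simp: Suc)
      then have y: "X = y 0 *\<^sub>R A 1 + (\<Sum>j<e. y (Suc j) *\<^sub>R A (Suc (Suc j)))"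
        by (simp only: sum.lessThan_Suc_shift One_nat_def)
      obtain c where c: "matrix_exp X = (\<Sum>k<CARD('n). c k *\<^sub>R matrix_power X k)"
        using matrix_exp_eq_poly by blast
      \<comment> \<open>\<open>X\<close> moves along \<open>A 1\<close> while the coefficients
        \<open>c\<close> of its own exponential stay fixed, so \<open>g\<close> is continuous and
        \<open>g 0\<close> is the exponential of \<open>X\<close>.\<close>
      define g where "g t = map_matrix complex_of_real
        (\<Sum>k<CARD('n). c k *\<^sub>R matrix_power (X + t *\<^sub>R A 1) k)" for t
      have "g t \<in> range ?\<phi>" if "t \<noteq> - y 0" for t
      proof -
        \<comment> \<open>The coefficient of \<open>A 1\<close> in
          \<open>X + t *\<^sub>R A 1\<close>, nonzero by the choice of \<open>t\<close>.\<close>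
        define s where "s = y 0 + t"
        have "s \<noteq> 0" using that by (auto simp: s_def)
        let ?Y = "A 1 + (\<Sum>j<e. (y (Suc j) / s) *\<^sub>R A (Suc (Suc j)))"
        have "s *\<^sub>R ?Y = s *\<^sub>R A 1 + (\<Sum>j<e. y (Suc j) *\<^sub>R A (Suc (Suc j)))"
          using \<open>s \<noteq> 0\<close> by (simp add: scaleR_add_right scaleR_sum_right)
        then have "X + t *\<^sub>R A 1 = s *\<^sub>R ?Y"
          unfolding y s_def by (simp add: scaleR_add_left)
        then have "g t = map_matrix complex_of_real
            (\<Sum>k<CARD('n). (c k * s ^ k) *\<^sub>R matrix_power ?Y k)"
          by (simp add: g_def matrix_power_scaleR)
        then show ?thesis using gibbs_param_range by simp
      qed
      then have "g ` (- {- y 0}) \<subseteq> closure (range ?\<phi>)"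
        using closure_subset[of "range ?\<phi>"] by auto
      moreover have "continuous_on (closure (- {- y 0})) g"
        unfolding g_def
        by (intro continuous_on_map_matrix_of_real continuous_on_sum continuous_on_scaleR
            continuous_on_matrix_power continuous_intros)
      ultimately have "g ` closure (- {- y 0}) \<subseteq> closure (range ?\<phi>)"
        by (intro image_closure_subset) auto
      \<comment> \<open>The real line without one point is dense, so \<open>t = 0\<close> is covered
        even when \<open>y 0 = 0\<close>.\<close>
      then have "g 0 \<in> closure (range ?\<phi>)"
        by (auto simp: closure_complement)
      then show "map_matrix complex_of_real (matrix_exp X) \<in> closure (range ?\<phi>)"
        by (simp add: g_def c)
    qed
    \<comment> \<open>As \<open>d = Suc e\<close>, the number \<open>CARD('n) + e\<close> of
      parameters is \<open>CARD('n) + d - 1\<close>.\<close>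
    then show ?thesis
      unfolding gibbs_variety_def gibbs_manifold_def image_image
      using variety_dim_closure_le[OF poly_param_gibbs_param] by (simp add: Suc)
  qed
  ultimately show ?thesis by blast
qed

end
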